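(* For every integer $n\ge 1$, $\psi_{sq}(P_n)=\beta_2(P_n)=\lceil 2n/3\rceil$. For every integer $n\ge 3$, $\psi_{sq}(C_n)=\beta_2(C_n)=\lfloor 2n/3\rfloor$.
   Context: All graphs are finite, simple and undirected. $P_n$ and $C_n$ are the path and the cycle on $n$ vertices. $N_G[v]$ denotes the closed neighborhood of $v$ in $G$. A sub-quorum coloring of $G$ with $k$ colors is an onto partial map $f:V(G)\dashrightarrow\{1,\ldots,k\}$ such that, with $S=\operatorname{dom}(f)$, every $v\in S$ satisfies $|\{u\in N_G[v]\cap S: f(u)=f(v)\}|\ge\frac12|N_G[v]\cap S|$; $\psi_{sq}(G)$ is the maximum such $k$. A set $S\subseteq V(G)$ is $2$-independent if the induced subgraph $G[S]$ has maximum degree at most $1$; $\beta_2(G)$ is the maximum cardinality of a $2$-independent set. *)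

theory Defs
  imports Complex_Main "Graph_Theory.Digraph_Component" "Graph_Theory.Pair_Digraph"
begin

text \<open>
  A finite simple undirected graph is a symmetric loop-free digraph without parallel arcs
  (the locale \<^locale>\<open>graph\<close>), so every edge is present as two opposite arcs, and the degree
  of a vertex is its \<^const>\<open>out_degree\<close>.
\<close>

definition path_graph :: "nat \<Rightarrow> (nat, nat \<times> nat) pre_digraph" where
  "path_graph n = with_proj
     \<lparr> pverts = {..<n},
       parcs = {(i, j). i < n \<and> j < n \<and> (j = i + 1 \<or> i = j + 1)} \<rparr>"

text \<open>Only meant for \<open>n \<ge> 3\<close>: for smaller $n$ the arcs below do not form a cycle.\<close>

definition cycle_graph :: "nat \<Rightarrow> (nat, nat \<times> nat) pre_digraph" where
  "cycle_graph n = with_proj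
     \<lparr> pverts = {..<n},
       parcs = {(i, j). i < n \<and> j < n \<and> (j = (i + 1) mod n \<or> i = (j + 1) mod n)} \<rparr>"

lemma graph_path_graph: "graph (path_graph n)"
proof -
  have "finite ({..<n} \<times> {..<n})" by simp
  then have "finite {(i, j). i < n \<and> j < n \<and> (j = i + 1 \<or> i = j + 1)}"
    by (rule rev_finite_subset) auto
  then have "pair_graph \<lparr> pverts = {..<n},
       parcs = {(i, j). i < n \<and> j < n \<and> (j = i + 1 \<or> i = j + 1)} \<rparr>"
    by unfold_locales (auto simp: symmetric_def intro!: symI)
  then show ?thesis
    unfolding path_graph_def by (rule pair_graph.pair_graphD_graph)
qed

lemma graph_cycle_graph:
  assumes "n \<ge> 3"
  shows "graph (cycle_graph n)"
proof -
  have noloop: "(i + 1) mod n \<noteq> i" if "i < n" for i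
    using that assms by (cases "i + 1 = n") auto
  have "finite ({..<n} \<times> {..<n})" by simp
  then have "finite {(i, j). i < n \<and> j < n \<and> (j = (i + 1) mod n \<or> i = (j + 1) mod n)}"
    by (rule rev_finite_subset) auto
  then have "pair_graph \<lparr> pverts = {..<n},
       parcs = {(i, j). i < n \<and> j < n \<and> (j = (i + 1) mod n \<or> i = (j + 1) mod n)} \<rparr>"
    using noloop noloop[symmetric]
    by unfold_locales (auto simp: symmetric_def intro!: symI)
  then show ?thesis
    unfolding cycle_graph_def by (rule pair_graph.pair_graphD_graph)
qed

definition closed_nbhd :: "('a, 'b) pre_digraph \<Rightarrow> 'a \<Rightarrow> 'a set" where
  "closed_nbhd G v = insert v {u. v \<rightarrow>\<^bsub>G\<^esub> u}"

definition sub_quorum_coloring ::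
    "('a, 'b) pre_digraph \<Rightarrow> nat \<Rightarrow> ('a \<rightharpoonup> nat) \<Rightarrow> bool" where
  "sub_quorum_coloring G k f \<longleftrightarrow>
     dom f \<subseteq> verts G \<and> ran f = {1..k} \<and>
     (\<forall>v \<in> dom f.
        real (card {u \<in> closed_nbhd G v \<inter> dom f. f u = f v})
          \<ge> 1 / 2 * real (card (closed_nbhd G v \<inter> dom f)))"

definition sub_quorum_number :: "('a, 'b) pre_digraph \<Rightarrow> nat" (\<open>\<psi>\<^sub>s\<^sub>q\<close>) where
  "\<psi>\<^sub>s\<^sub>q G = Max {k. \<exists>f. sub_quorum_coloring G k f}"

definition two_independent :: "('a, 'b) pre_digraph \<Rightarrow> 'a set \<Rightarrow> bool" where
  "two_independent G S \<longleftrightarrow>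
     S \<subseteq> verts G \<and> (\<forall>v \<in> S. out_degree (G \<restriction> S) v \<le> 1)"

definition two_independence_number :: "('a, 'b) pre_digraph \<Rightarrow> nat" (\<open>\<beta>\<^sub>2\<close>) where
  "\<beta>\<^sub>2 G = Max {card S | S. two_independent G S}"

text \<open>\<^const>\<open>Max\<close> is unspecified on infinite and on empty sets; both maxima are attained.\<close>

lemma (in fin_digraph) sub_quorum_number_wf:
  "finite {k. \<exists>f. sub_quorum_coloring G k f}" "{k. \<exists>f. sub_quorum_coloring G k f} \<noteq> {}"
proof -
  have "k \<le> card (verts G)" if "sub_quorum_coloring G k f" for k f
  proof -
    from that have sub: "dom f \<subseteq> verts G" and ran: "ran f = {1..k}"
      by (auto simp: sub_quorum_coloring_def)
    have fin: "finite (dom f)"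
      using sub finite_verts by (rule finite_subset)
    have "k = card (ran f)" by (simp add: ran)
    also have "ran f \<subseteq> (\<lambda>v. the (f v)) ` dom f"
      by (force simp: ran_def)
    then have "card (ran f) \<le> card (dom f)"
      using fin by (rule surj_card_le[rotated])
    also have "\<dots> \<le> card (verts G)"
      using sub by (simp add: card_mono)
    finally show ?thesis .
  qed
  then have "{k. \<exists>f. sub_quorum_coloring G k f} \<subseteq> {..card (verts G)}" by auto
  then show "finite {k. \<exists>f. sub_quorum_coloring G k f}"
    by (rule finite_subset) simp
  have "sub_quorum_coloring G 0 Map.empty"
    by (simp add: sub_quorum_coloring_def)
  then show "{k. \<exists>f. sub_quorum_coloring G k f} \<noteq> {}" by blast
qed

lemma (in fin_digraph) two_independence_number_wf:
  "finite {card S | S. two_independent G S}" "{card S | S. two_independent G S} \<noteq> {}"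
proof -
  have "{card S | S. two_independent G S} \<subseteq> card ` Pow (verts G)"
    by (auto simp: two_independent_def)
  then show "finite {card S | S. two_independent G S}"
    by (rule finite_subset) simp
  have "two_independent G {}"
    by (simp add: two_independent_def)
  then show "{card S | S. two_independent G S} \<noteq> {}" by blast
qed

end

theory Submission
  imports Defs
begin

text \<open>
  Every 2-independent set becomes a sub-quorum coloring when its vertices get pairwise distinct
  colors, since a closed neighborhood then meets the domain in at most two vertices.  Conversely,
  suppose that every closed neighborhood has at most three vertices, and select one vertex of each
  color of a sub-quorum coloring.  If a selected vertex had two selected neighbors, its closed
  neighborhood would consist of three vertices of three different colors, while the quorum
  condition asks for two of its own color.  So the selection is 2-independent.  Hence
  \<open>\<psi>\<^sub>s\<^sub>q = \<beta>\<^sub>2\<close> in every graph of maximum degree at most two (\<open>sub_quorum_number_eq\<close>).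

  For the value of \<open>\<beta>\<^sub>2\<close> in such a graph, a closed neighborhood $N[v]$ meets a 2-independent set
  $S$ in at most two vertices, whether or not $v$ lies in $S$.  Counting the pairs $(v,u)$ with
  $u \<in> S \<inter> N[v]$ in two ways bounds the sum of $|N[u]|$ over $u \<in> S$ by $2n$.  In the cycle all
  closed neighborhoods have three vertices, so $3|S| \<le> 2n$; in the path the two ends
  fall short of three by two altogether, so $3|S| \<le> 2n+2$.  Both bounds are attained by leaving
  out every third vertex, in the cycle after removing the last vertex to obtain a path.
\<close>

section \<open>Two-independence through closed neighborhoods\<close>

lemma (in fin_digraph) finite_closed_nbhd: "finite (closed_nbhd G v)"
proof -
  have "{u. v \<rightarrow>\<^bsub>G\<^esub> u} \<subseteq> verts G"
    by auto
  then show ?thesis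
    unfolding closed_nbhd_def using finite_verts by (simp add: finite_subset)
qed

lemma (in digraph) closed_nbhd_subset: "v \<in> verts G \<Longrightarrow> closed_nbhd G v \<subseteq> verts G"
  by (auto simp: closed_nbhd_def)

lemma (in digraph) out_degree_induce_subgraph:
  assumes "S \<subseteq> verts G" "v \<in> S"
  shows "out_degree (G \<restriction> S) v = card {u \<in> S. v \<rightarrow>\<^bsub>G\<^esub> u}"
proof -
  have "bij_betw (head G) (out_arcs (G \<restriction> S) v) {u \<in> S. v \<rightarrow>\<^bsub>G\<^esub> u}"
  proof (rule bij_betwI')
    fix x y assume "x \<in> out_arcs (G \<restriction> S) v" "y \<in> out_arcs (G \<restriction> S) v"
    then show "head G x = head G y \<longleftrightarrow> x = y"
      using no_multi_arcs[of x y] by (auto simp: arc_to_ends_def)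
  next
    fix x assume "x \<in> out_arcs (G \<restriction> S) v"
    then show "head G x \<in> {u \<in> S. v \<rightarrow>\<^bsub>G\<^esub> u}"
      by (auto simp: dominatesI arc_to_ends_def)
  next
    fix u assume "u \<in> {u \<in> S. v \<rightarrow>\<^bsub>G\<^esub> u}"
    then show "\<exists>x \<in> out_arcs (G \<restriction> S) v. u = head G x"
      using assms by (fastforce simp: arcs_ends_def arc_to_ends_def)
  qed
  then show ?thesis
    unfolding out_degree_def by (rule bij_betw_same_card)
qed

text \<open>
  Passing to closed neighborhoods puts 2-independence in the form in which the quorum condition
  is stated; the bound rises from one to two because the vertex itself is now counted.
\<close>

lemma (in digraph) two_independent_iff_closed_nbhd:
  "two_independent G S \<longleftrightarrow> S \<subseteq> verts G \<and> (\<forall>v \<in> S. card (closed_nbhd G v \<inter> S) \<le> 2)"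
proof -
  have "out_degree (G \<restriction> S) v \<le> 1 \<longleftrightarrow> card (closed_nbhd G v \<inter> S) \<le> 2"
    if "S \<subseteq> verts G" "v \<in> S" for v
  proof -
    have "closed_nbhd G v \<inter> S = insert v {u \<in> S. v \<rightarrow>\<^bsub>G\<^esub> u}"
      using that by (auto simp: closed_nbhd_def)
    moreover have "v \<notin> {u \<in> S. v \<rightarrow>\<^bsub>G\<^esub> u}"
      using adj_not_same by auto
    moreover have "finite {u \<in> S. v \<rightarrow>\<^bsub>G\<^esub> u}"
      using that finite_subset[OF _ finite_verts] by simp
    ultimately show ?thesis
      using out_degree_induce_subgraph[OF that] by simp
  qed
  then show ?thesis
    by (auto simp: two_independent_def)
qed

section \<open>Sub-quorum colorings against 2-independent sets\<close>

text \<open>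
  A closed neighborhood centered in $S$ meets $S$ at most twice, so its center alone already makes
  up the required half.
\<close>

lemma (in digraph) rainbow_sub_quorum_coloring:
  assumes S: "two_independent G S"
  shows "\<exists>f. sub_quorum_coloring G (card S) f"
proof -
  have sub: "S \<subseteq> verts G" and two: "\<And>v. v \<in> S \<Longrightarrow> card (closed_nbhd G v \<inter> S) \<le> 2"
    using S by (auto simp: two_independent_iff_closed_nbhd)
  have "finite S"
    using sub finite_verts by (rule finite_subset)
  then obtain h where h: "bij_betw h S {1..card S}"
    using bij_betw_inv_into ex_bij_betw_nat_finite_1 by blast
  define f where "f = (\<lambda>v. if v \<in> S then Some (h v) else None)"
  have dom: "dom f = S"
    by (auto simp: f_def dom_def)
  have "ran f = h ` S"
    by (auto simp: f_def ran_def)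
  then have ran: "ran f = {1..card S}"
    using h by (simp add: bij_betw_def)
  have "1 \<le> card {u \<in> closed_nbhd G v \<inter> S. f u = f v}" if "v \<in> S" for v
  proof -
    have "v \<in> {u \<in> closed_nbhd G v \<inter> S. f u = f v}"
      using that by (simp add: closed_nbhd_def)
    moreover have "finite {u \<in> closed_nbhd G v \<inter> S. f u = f v}"
      using \<open>finite S\<close> by simp
    ultimately show ?thesis
      by (metis One_nat_def Suc_leI card_gt_0_iff empty_iff)
  qed
  then have "sub_quorum_coloring G (card S) f"
    using sub two by (fastforce simp: sub_quorum_coloring_def dom ran)
  then show ?thesis
    by blast
qed

text \<open>
  The 2-independent set is a transversal of the color classes.  In a closed neighborhood at most
  half of the domain vertices, hence at most one of at most three, differ in color from the
  center; the others share its color, so the center is the only one selected among them.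
\<close>

lemma (in digraph) two_independent_transversal:
  assumes deg: "\<And>v. v \<in> verts G \<Longrightarrow> card (closed_nbhd G v) \<le> 3"
    and f: "sub_quorum_coloring G k f"
  shows "\<exists>T. two_independent G T \<and> card T = k"
proof -
  have sub: "dom f \<subseteq> verts G" and ran: "ran f = {1..k}"
    using f by (auto simp: sub_quorum_coloring_def)
  have quorum:
    "card (closed_nbhd G v \<inter> dom f) \<le> 2 * card {u \<in> closed_nbhd G v \<inter> dom f. f u = f v}"
    if "v \<in> dom f" for v
  proof -
    have "1 / 2 * real (card (closed_nbhd G v \<inter> dom f))
        \<le> real (card {u \<in> closed_nbhd G v \<inter> dom f. f u = f v})"
      using f that unfolding sub_quorum_coloring_def by blast
    then show ?thesis
      by linarith
  qed
  have "\<forall>c \<in> {1..k}. \<exists>v. f v = Some c"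
    using ran by (auto simp: ran_def)
  then obtain r where r: "\<And>c. c \<in> {1..k} \<Longrightarrow> f (r c) = Some c"
    by metis
  define T where "T = r ` {1..k}"
  have "inj_on r {1..k}"
    by (rule inj_onI) (metis option.inject r)
  then have card_T: "card T = k"
    by (simp add: T_def card_image)
  have T_dom: "T \<subseteq> dom f"
    using r by (auto simp: T_def)
  have rainbow: "u = v" if "u \<in> T" "v \<in> T" "f u = f v" for u v
    using that r by (auto simp: T_def)
  have "card (closed_nbhd G v \<inter> T) \<le> 2" if v: "v \<in> T" for v
  proof -
    let ?N = "closed_nbhd G v \<inter> dom f"
    let ?M = "{u \<in> ?N. f u = f v}"
    have fin: "finite ?N"
      using finite_closed_nbhd by simp
    have "card ?N \<le> card (closed_nbhd G v)"
      using finite_closed_nbhd by (simp add: card_mono)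
    also have "\<dots> \<le> 3"
      using deg sub T_dom v by blast
    finally have "card ?N \<le> 3" .
    moreover have "card ?N \<le> 2 * card ?M"
      using quorum T_dom v by blast
    moreover have "card (?N - ?M) = card ?N - card ?M"
      by (intro card_Diff_subset finite_subset[OF _ fin]) auto
    ultimately have "card (?N - ?M) \<le> 1"
      by linarith
    moreover have "closed_nbhd G v \<inter> T \<subseteq> insert v (?N - ?M)"
      using rainbow v T_dom by blast
    then have "card (closed_nbhd G v \<inter> T) \<le> card (insert v (?N - ?M))"
      using fin by (intro card_mono) auto
    moreover have "card (insert v (?N - ?M)) \<le> Suc (card (?N - ?M))"
      by (rule card_insert_le_m1) auto
    ultimately show ?thesis
      by linarith
  qed
  then have "two_independent G T"
    using T_dom sub by (auto simp: two_independent_iff_closed_nbhd)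
  with card_T show ?thesis
    by blast
qed

lemma (in digraph) sub_quorum_number_eq:
  assumes "\<And>v. v \<in> verts G \<Longrightarrow> card (closed_nbhd G v) \<le> 3"
  shows "\<psi>\<^sub>s\<^sub>q G = \<beta>\<^sub>2 G"
proof -
  have "{k. \<exists>f. sub_quorum_coloring G k f} = {card S | S. two_independent G S}"
    using rainbow_sub_quorum_coloring two_independent_transversal[OF assms] by blast
  then show ?thesis
    by (simp add: sub_quorum_number_def two_independence_number_def)
qed

section \<open>The counting bound\<close>

lemma (in graph) closed_nbhd_sym: "u \<in> closed_nbhd G v \<longleftrightarrow> v \<in> closed_nbhd G u"
proof -
  have "v \<rightarrow>\<^bsub>G\<^esub> u \<longleftrightarrow> u \<rightarrow>\<^bsub>G\<^esub> v"
    using sym_arcs unfolding symmetric_def sym_def by blast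
  then show ?thesis
    by (auto simp: closed_nbhd_def)
qed

text \<open>
  For $v$ outside $S$ the bound $|N[v] \<inter> S| \<le> 2$ comes from the degree condition instead of
  from 2-independence.  The last sum measures how far $G$ is from being 2-regular.
\<close>

lemma (in graph) card_two_independent_le:
  assumes deg: "\<And>v. v \<in> verts G \<Longrightarrow> card (closed_nbhd G v) \<le> 3"
    and S: "two_independent G S"
  shows "3 * card S \<le> 2 * card (verts G) + (\<Sum>v \<in> verts G. 3 - card (closed_nbhd G v))"
proof -
  let ?N = "closed_nbhd G"
  have sub: "S \<subseteq> verts G" and two: "\<And>v. v \<in> S \<Longrightarrow> card (?N v \<inter> S) \<le> 2"
    using S by (auto simp: two_independent_iff_closed_nbhd)
  have fin: "finite S"
    using sub finite_verts by (rule finite_subset)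
  have le: "card (?N v \<inter> S) \<le> 2" if v: "v \<in> verts G" for v
  proof (cases "v \<in> S")
    case False
    have "?N v \<inter> S \<subseteq> ?N v - {v}"
      using False by auto
    then have "card (?N v \<inter> S) \<le> card (?N v - {v})"
      using finite_closed_nbhd by (intro card_mono) auto
    also have "\<dots> = card (?N v) - 1"
      by (rule card_Diff_singleton) (simp add: closed_nbhd_def)
    finally show ?thesis
      using deg[OF v] by linarith
  qed (rule two)
  have "(\<Sum>u \<in> S. card (?N u)) = (\<Sum>u \<in> S. \<Sum>v | v \<in> verts G \<and> u \<in> ?N v. 1)"
  proof (rule sum.cong[OF refl])
    fix u assume "u \<in> S"
    then have "?N u = {v \<in> verts G. u \<in> ?N v}"
      using sub closed_nbhd_subset[of u] closed_nbhd_sym by blast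
    then show "card (?N u) = (\<Sum>v | v \<in> verts G \<and> u \<in> ?N v. 1)"
      by simp
  qed
  also have "\<dots> = (\<Sum>v \<in> verts G. \<Sum>u | u \<in> S \<and> u \<in> ?N v. 1)"
    using fin finite_verts by (rule sum.swap_restrict)
  also have "\<dots> = (\<Sum>v \<in> verts G. card (?N v \<inter> S))"
    by (intro sum.cong refl) (simp add: Int_def conj_commute)
  also have "\<dots> \<le> (\<Sum>v \<in> verts G. 2)"
    by (intro sum_mono le)
  finally have count: "(\<Sum>u \<in> S. card (?N u)) \<le> 2 * card (verts G)"
    by simp
  have "3 * card S = (\<Sum>u \<in> S. card (?N u) + (3 - card (?N u)))"
    using deg sub by (subst sum.cong[OF refl, where h = "\<lambda>_. 3"]) (auto simp: subset_iff)
  also have "\<dots> = (\<Sum>u \<in> S. card (?N u)) + (\<Sum>u \<in> S. 3 - card (?N u))"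
    by (rule sum.distrib)
  also have "(\<Sum>u \<in> S. 3 - card (?N u)) \<le> (\<Sum>u \<in> verts G. 3 - card (?N u))"
    using sub by (intro sum_mono2) auto
  finally show ?thesis
    using count by linarith
qed

lemma (in fin_digraph) two_independence_number_eqI:
  assumes "two_independent G S" "card S = m"
    and "\<And>S. two_independent G S \<Longrightarrow> card S \<le> m"
  shows "\<beta>\<^sub>2 G = m"
  unfolding two_independence_number_def
  using assms two_independence_number_wf(1) by (intro Max_eqI) auto

section \<open>Leaving out every third vertex\<close>

lemma card_not_third: "card {i. i < n \<and> i mod 3 \<noteq> 2} = (2 * n + 2) div (3::nat)"
proof (induction n)
  case (Suc n)
  have eq: "{i. i < Suc n \<and> i mod 3 \<noteq> 2} =
      (if n mod 3 = 2 then {i. i < n \<and> i mod 3 \<noteq> 2} else insert n {i. i < n \<and> i mod 3 \<noteq> 2})"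
    by (auto simp: less_Suc_eq)
  show ?case
    unfolding eq using Suc.IH by simp presburger
qed simp

text \<open>
  The numbers not congruent to $2$ modulo $3$ fall into pairs $3q, 3q+1$, and consecutive numbers
  among them lie in the same pair.
\<close>

lemma card_neighbors_not_third:
  fixes v :: nat
  assumes "v mod 3 \<noteq> 2" "A \<subseteq> {i. i mod 3 \<noteq> 2 \<and> i \<le> v + 1 \<and> v \<le> i + 1}"
  shows "card A \<le> 2"
proof -
  let ?B = "{v, if v mod 3 = 0 then v + 1 else v - 1}"
  have "i \<in> ?B" if "i mod 3 \<noteq> 2" "i \<le> v + 1" "v \<le> i + 1" for i
    using that assms(1) by simp presburger
  then have "A \<subseteq> ?B"
    using assms(2) by blast
  then have "card A \<le> card ?B"
    by (intro card_mono) auto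
  also have "\<dots> \<le> 2"
    by (simp add: card_insert_if)
  finally show ?thesis .
qed

section \<open>Paths\<close>

lemma verts_path_graph: "verts (path_graph n) = {..<n}"
  by (simp add: path_graph_def)

lemma closed_nbhd_path_graph:
  assumes "v < n"
  shows "closed_nbhd (path_graph n) v = {i. i < n \<and> i \<le> v + 1 \<and> v \<le> i + 1}"
  using assms by (auto simp: closed_nbhd_def path_graph_def arcs_ends_def arc_to_ends_def)

text \<open>
  Each end of the path lacks one neighbor; for $n = 1$ the two ends coincide and both terms count.
\<close>

lemma card_closed_nbhd_path_graph:
  assumes "v < n"
  shows "card (closed_nbhd (path_graph n) v) + of_bool (v = 0) + of_bool (v = n - 1) = 3"
proof -
  have "closed_nbhd (path_graph n) v = {v - 1..min (v + 1) (n - 1)}"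
    using assms by (auto simp: closed_nbhd_path_graph)
  then show ?thesis
    using assms by (auto simp: min_def)
qed

lemma two_independence_number_path_graph:
  assumes "n \<ge> 1"
  shows "\<beta>\<^sub>2 (path_graph n) = (2 * n + 2) div 3"
proof -
  interpret graph "path_graph n"
    by (rule graph_path_graph)
  let ?S = "{i. i < n \<and> i mod 3 \<noteq> 2}"
  have deg: "card (closed_nbhd (path_graph n) v) \<le> 3" if "v \<in> verts (path_graph n)" for v
    using that card_closed_nbhd_path_graph[of v n] by (simp add: verts_path_graph)
  show ?thesis
  proof (rule two_independence_number_eqI[OF _ card_not_third])
    have "closed_nbhd (path_graph n) v \<inter> ?S \<subseteq> {i. i mod 3 \<noteq> 2 \<and> i \<le> v + 1 \<and> v \<le> i + 1}"
      if v: "v \<in> ?S" for v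
      using v by (auto simp: closed_nbhd_path_graph)
    then have "card (closed_nbhd (path_graph n) v \<inter> ?S) \<le> 2" if "v \<in> ?S" for v
      using that card_neighbors_not_third by blast
    then show "two_independent (path_graph n) ?S"
      by (auto simp: two_independent_iff_closed_nbhd verts_path_graph)
  next
    fix S assume "two_independent (path_graph n) S"
    note card_two_independent_le[OF deg this]
    moreover have "(\<Sum>v<n. 3 - card (closed_nbhd (path_graph n) v)) =
        (\<Sum>v<n. of_bool (v = 0) + of_bool (v = n - 1))"
    proof (rule sum.cong[OF refl])
      fix v assume "v \<in> {..<n}"
      then have "card (closed_nbhd (path_graph n) v) + of_bool (v = 0) + of_bool (v = n - 1) = 3"
        by (intro card_closed_nbhd_path_graph) simp
      then show "3 - card (closed_nbhd (path_graph n) v) = of_bool (v = 0) + of_bool (v = n - 1)"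
        by (metis add.assoc add_diff_cancel_left')
    qed
    moreover have "\<dots> = 2"
      using assms by (simp add: sum.distrib of_bool_def)
    ultimately show "card S \<le> (2 * n + 2) div 3"
      by (simp add: verts_path_graph)
  qed
qed

section \<open>Cycles\<close>

lemma verts_cycle_graph: "verts (cycle_graph n) = {..<n}"
  by (simp add: cycle_graph_def)

lemma closed_nbhd_cycle_graph:
  assumes "v < n"
  shows "closed_nbhd (cycle_graph n) v =
    {v, if v = n - 1 then 0 else v + 1, if v = 0 then n - 1 else v - 1}"
proof -
  have succ: "(i + 1) mod n = (if i = n - 1 then 0 else i + 1)" if "i < n" for i
    using that by auto
  have "closed_nbhd (cycle_graph n) v =
      insert v {i. i < n \<and> (i = (v + 1) mod n \<or> v = (i + 1) mod n)}"
    using assms by (auto simp: closed_nbhd_def cycle_graph_def arcs_ends_def arc_to_ends_def)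
  also have "\<dots> = insert v {i. i < n \<and> (i = (if v = n - 1 then 0 else v + 1) \<or>
      v = (if i = n - 1 then 0 else i + 1))}"
    using assms by (simp only: succ cong: conj_cong)
  also have "\<dots> = {v, if v = n - 1 then 0 else v + 1, if v = 0 then n - 1 else v - 1}"
    using assms by (auto split: if_splits)
  finally show ?thesis .
qed

lemma card_closed_nbhd_cycle_graph:
  assumes "n \<ge> 3" "v < n"
  shows "card (closed_nbhd (cycle_graph n) v) = 3"
proof -
  consider "v = 0" | "v = n - 1" | "0 < v" "v < n - 1"
    using assms by linarith
  then show ?thesis
    using assms by cases (simp_all add: closed_nbhd_cycle_graph card_insert_if)
qed

lemma two_independence_number_cycle_graph:
  assumes n: "n \<ge> 3"
  shows "\<beta>\<^sub>2 (cycle_graph n) = 2 * n div 3"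
proof -
  interpret graph "cycle_graph n"
    by (rule graph_cycle_graph[OF n])
  \<comment> \<open>Without the vertex $n - 1$ the cycle is a path on $n - 1$ vertices.\<close>
  let ?S = "{i. i < n - 1 \<and> i mod 3 \<noteq> 2}"
  show ?thesis
  proof (rule two_independence_number_eqI)
    have "closed_nbhd (cycle_graph n) v \<inter> ?S \<subseteq> {i. i mod 3 \<noteq> 2 \<and> i \<le> v + 1 \<and> v \<le> i + 1}"
      if v: "v \<in> ?S" for v
    proof
      fix i assume "i \<in> closed_nbhd (cycle_graph n) v \<inter> ?S"
      then have i: "i < n - 1" "i mod 3 \<noteq> 2" and "i \<in> closed_nbhd (cycle_graph n) v"
        by simp_all
      moreover have "closed_nbhd (cycle_graph n) v =
          {v, v + 1, if v = 0 then n - 1 else v - 1}"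
        using v by (subst closed_nbhd_cycle_graph) auto
      ultimately have "i = v \<or> i = v + 1 \<or> v \<noteq> 0 \<and> i = v - 1"
        by (auto split: if_splits)
      with i show "i \<in> {i. i mod 3 \<noteq> 2 \<and> i \<le> v + 1 \<and> v \<le> i + 1}"
        by auto
    qed
    then have "card (closed_nbhd (cycle_graph n) v \<inter> ?S) \<le> 2" if "v \<in> ?S" for v
      using that card_neighbors_not_third by blast
    then show "two_independent (cycle_graph n) ?S"
      by (auto simp: two_independent_iff_closed_nbhd verts_cycle_graph)
    have "2 * (n - 1) + 2 = 2 * n"
      using n by linarith
    then show "card ?S = 2 * n div 3"
      by (simp add: card_not_third)
  next
    fix S assume "two_independent (cycle_graph n) S"
    then have "3 * card S \<le> 2 * card (verts (cycle_graph n)) +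
        (\<Sum>v \<in> verts (cycle_graph n). 3 - card (closed_nbhd (cycle_graph n) v))"
      using n by (intro card_two_independent_le)
        (auto simp: card_closed_nbhd_cycle_graph verts_cycle_graph)
    then show "card S \<le> 2 * n div 3"
      using n by (simp add: card_closed_nbhd_cycle_graph verts_cycle_graph)
  qed
qed

section \<open>The values for paths and cycles\<close>

theorem theorem5p1:
  shows "(\<forall>n::nat. n \<ge> 1 \<longrightarrow>
           \<psi>\<^sub>s\<^sub>q (path_graph n) = \<beta>\<^sub>2 (path_graph n) \<and>
           int (\<beta>\<^sub>2 (path_graph n)) = \<lceil>2 * real n / 3\<rceil>) \<and>
         (\<forall>n::nat. n \<ge> 3 \<longrightarrow>
           \<psi>\<^sub>s\<^sub>q (cycle_graph n) = \<beta>\<^sub>2 (cycle_graph n) \<and>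
           int (\<beta>\<^sub>2 (cycle_graph n)) = \<lfloor>2 * real n / 3\<rfloor>)"
proof (intro conjI allI impI)
  fix n :: nat assume n: "n \<ge> 1"
  interpret graph "path_graph n"
    by (rule graph_path_graph)
  show "\<psi>\<^sub>s\<^sub>q (path_graph n) = \<beta>\<^sub>2 (path_graph n)"
  proof (rule sub_quorum_number_eq)
    fix v assume "v \<in> verts (path_graph n)"
    then show "card (closed_nbhd (path_graph n) v) \<le> 3"
      using card_closed_nbhd_path_graph[of v n] by (simp add: verts_path_graph)
  qed
  have "3 * ((2 * n + 2) div 3) \<le> 2 * n + 2" "2 * n \<le> 3 * ((2 * n + 2) div 3)"
    by presburger+
  then have "real (3 * ((2 * n + 2) div 3)) \<le> real (2 * n + 2)"
    "real (2 * n) \<le> real (3 * ((2 * n + 2) div 3))"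
    by (simp_all only: of_nat_le_iff)
  then have "\<lceil>2 * real n / 3\<rceil> = int ((2 * n + 2) div 3)"
    by (intro ceiling_unique) simp_all
  then show "int (\<beta>\<^sub>2 (path_graph n)) = \<lceil>2 * real n / 3\<rceil>"
    by (simp add: two_independence_number_path_graph[OF n])
next
  fix n :: nat assume n: "n \<ge> 3"
  interpret graph "cycle_graph n"
    by (rule graph_cycle_graph[OF n])
  show "\<psi>\<^sub>s\<^sub>q (cycle_graph n) = \<beta>\<^sub>2 (cycle_graph n)"
    using n by (intro sub_quorum_number_eq)
      (simp add: verts_cycle_graph card_closed_nbhd_cycle_graph)
  have "\<lfloor>2 * real n / 3\<rfloor> = int (2 * n div 3)"
    using floor_divide_of_nat_eq[where ?'a = real, of "2 * n" 3] by simp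
  then show "int (\<beta>\<^sub>2 (cycle_graph n)) = \<lfloor>2 * real n / 3\<rfloor>"
    by (simp add: two_independence_number_cycle_graph[OF n])
qed

end
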